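(* The abstract matching operator $\mathsf{match}_{\mathrm{Sh}}$ is correct with respect to $\mathsf{match}_{\mathrm{Ps}}$: for all $\chi_1,\chi_2\in\mathtt{Psub}$, $$\alpha_{\mathrm{Sh}}(\mathsf{match}_{\mathrm{Ps}}(\chi_1,\chi_2))\sqsubseteq_{\mathrm{Sh}}\mathsf{match}_{\mathrm{Sh}}(\alpha_{\mathrm{Sh}}(\chi_1),\alpha_{\mathrm{Sh}}(\chi_2)).$$
   Context: **Substitutions.** Fix a first-order signature with at least one constant and one function symbol of arity $\ge 2$, and an infinite set $\mathcal V$ of variables; $\wp_f$ denotes finite subsets, and $\mathrm{vars}(o)$ is the set of variables occurring in $o$. A substitution is a map $\theta$ from $\mathcal V$ to terms with finite $\mathrm{dom}(\theta)=\{x\mid\theta(x)\neq x\}$, extended to terms; $\mathrm{rng}(\theta)$ is the set of variables of the terms $\theta(x)$, $x\in\mathrm{dom}(\theta)$; $\mathrm{vars}(\theta)=\mathrm{dom}(\theta)\cup\mathrm{rng}(\theta)$. $\mathit{ISubst}$ is the set of idempotent substitutions ($\mathrm{dom}\cap\mathrm{rng}=\emptyset$); a renaming is a substitution that is a bijection $\mathcal V\to\mathcal V$. $\mathrm{mgu}(\sigma_1,\sigma_2)$ denotes an idempotent most general unifier of $\{x=\sigma_i(x)\mid i\in\{1,2\},x\in\mathrm{dom}(\sigma_i)\}$ with variables among those of these equations, if it exists. **Existential substitutions.** For $U\in\wp_f(\mathcal V)$: $\theta_1\preceq_U\theta_2$ iff there is a substitution $\delta$ with $\theta_1(u)=\delta(\theta_2(u))$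 for all $u\in U$; $\theta_1\sim_U\theta_2$ iff there is a renaming $\rho$ with $\theta_1(u)=\rho(\theta_2(u))$ for all $u\in U$; $[\theta]_U$ is the $\sim_U$-class of $\theta\in\mathit{ISubst}$, $\mathit{ISubst}_{\sim_U}$ the set of such classes. $\mathrm{mgu}([\theta_1]_U,[\theta_2]_V)=[\mathrm{mgu}(\theta_1',\theta_2')]_{U\cup V}$ where $\theta_1\sim_U\theta_1'\in\mathit{ISubst}$, $\theta_2\sim_V\theta_2'\in\mathit{ISubst}$ and $(U\cup\mathrm{vars}(\theta_1'))\cap(V\cup\mathrm{vars}(\theta_2'))\subseteq U\cap V$ (independent of choices; undefined if not unifiable). **Domains.** $\mathtt{Psub}=\{[\Theta,U]\mid\Theta\subseteq\mathit{ISubst}_{\sim_U},U\in\wp_f(\mathcal V)\}\cup\{\bot_{\mathrm{Ps}},\top_{\mathrm{Ps}}\}$, with bottom $\bot_{\mathrm{Ps}}$, top $\top_{\mathrm{Ps}}$, and $[\Theta_1,U_1]\sqsubseteq_{\mathrm{Ps}}[\Theta_2,U_2]$ iff $U_1=U_2$, $\Theta_1\subseteq\Theta_2$. $\mathtt{Sharing}=\{[A,U]\mid A\subseteq\wp(U),(A\ne\emptyset\Rightarrow\emptyset\in A),U\in\wp_f(\mathcal V)\}\cup\{\bot_{\mathrm{Sh}},\top_{\mathrm{Sh}}\}$, ordered by $\sqsubseteq_{\mathrm{Sh}}$ in the same way. With $\mathrm{occ}(\sigma,y)=\{z\in\mathcal V\mid y\in\mathrm{vars}(\sigma(z))\}$,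 $\alpha_{\mathrm{Sh}}([\sigma]_V)=[\{\mathrm{occ}(\sigma,y)\cap V\mid y\in\mathcal V\},V]$; $\alpha_{\mathrm{Sh}}:\mathtt{Psub}\to\mathtt{Sharing}$ maps bottom to bottom, top to top, and $\alpha_{\mathrm{Sh}}([\Theta,U])=[\bigcup_{[\sigma]_U\in\Theta}A_\sigma,U]$ where $\alpha_{\mathrm{Sh}}([\sigma]_U)=[A_\sigma,U]$. **Matching.** $\mathsf{match}_{\mathrm{Ps}}([\Theta_1,U_1],[\Theta_2,U_2])=[\{\mathrm{mgu}([\theta_1]_{U_1},[\theta_2]_{U_2})\mid[\theta_1]_{U_1}\in\Theta_1,[\theta_2]_{U_2}\in\Theta_2,\theta_1\preceq_{U_1\cap U_2}\theta_2\},U_1\cup U_2]$. For a set $A$ of finite sets of variables, $A^*=\{\bigcup T\mid\emptyset\ne T\in\wp_f(A)\}$. For all $[S_1,U_1],[S_2,U_2]\in\mathtt{Sharing}$, $$\mathsf{match}_{\mathrm{Sh}}([S_1,U_1],[S_2,U_2])=[S_1'\cup S_2'\cup\{X_1\cup X_2\mid X_1\in S_1'',X_2\in(S_2'')^*,X_1\cap U_2=X_2\cap U_1\},U_1\cup U_2]$$ where $S_1'=\{B\in S_1\mid B\cap U_2=\emptyset\}$, $S_1''=S_1\setminus S_1'$, $S_2'=\{B\in S_2\mid B\cap U_1=\emptyset\}$, $S_2''=S_2\setminus S_2'$. Both operators return bottom if some argument is bottom, and otherwise top if some argument is top. *)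

theory Defs
  imports Main
begin

section \<open>Terms and substitutions\<close>

text \<open>
  A signature is given by an arity function \<open>ar\<close> on the type of function symbols; \<open>Fun f ts\<close> is a
  term over the signature only if all its symbols respect \<open>ar\<close>.  Variables are the elements of \<open>'v\<close>.
\<close>

datatype (syms: 'f, vars: 'v) trm = Var 'v | Fun 'f "('f, 'v) trm list"

type_synonym ('f, 'v) subst = "'v \<Rightarrow> ('f, 'v) trm"

fun wf_trm :: "('f \<Rightarrow> nat) \<Rightarrow> ('f, 'v) trm \<Rightarrow> bool" where
  "wf_trm ar (Var x) \<longleftrightarrow> True"
| "wf_trm ar (Fun f ts) \<longleftrightarrow> length ts = ar f \<and> (\<forall>t\<in>set ts. wf_trm ar t)"

fun app :: "('f, 'v) subst \<Rightarrow> ('f, 'v) trm \<Rightarrow> ('f, 'v) trm" where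
  "app \<theta> (Var x) = \<theta> x"
| "app \<theta> (Fun f ts) = Fun f (map (app \<theta>) ts)"

definition sdom :: "('f, 'v) subst \<Rightarrow> 'v set" where
  "sdom \<theta> = {x. \<theta> x \<noteq> Var x}"

definition srng :: "('f, 'v) subst \<Rightarrow> 'v set" where
  "srng \<theta> = (\<Union>x\<in>sdom \<theta>. vars (\<theta> x))"

definition svars :: "('f, 'v) subst \<Rightarrow> 'v set" where
  "svars \<theta> = sdom \<theta> \<union> srng \<theta>"

definition Subst :: "('f \<Rightarrow> nat) \<Rightarrow> ('f, 'v) subst set" where
  "Subst ar = {\<theta>. (\<forall>x. wf_trm ar (\<theta> x)) \<and> finite (sdom \<theta>)}"

definition ISubst :: "('f \<Rightarrow> nat) \<Rightarrow> ('f, 'v) subst set" where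
  "ISubst ar = {\<theta> \<in> Subst ar. sdom \<theta> \<inter> srng \<theta> = {}}"

definition Renaming :: "('f \<Rightarrow> nat) \<Rightarrow> ('f, 'v) subst set" where
  "Renaming ar = {\<rho> \<in> Subst ar. \<exists>r. bij r \<and> \<rho> = (\<lambda>x. Var (r x))}"

section \<open>Most general unifiers\<close>

type_synonym ('f, 'v) eqns = "(('f, 'v) trm \<times> ('f, 'v) trm) set"

definition eqns_of :: "('f, 'v) subst \<Rightarrow> ('f, 'v) eqns" where
  "eqns_of \<sigma> = {(Var x, \<sigma> x) | x. x \<in> sdom \<sigma>}"

definition eqns_vars :: "('f, 'v) eqns \<Rightarrow> 'v set" where
  "eqns_vars E = (\<Union>(s, t)\<in>E. vars s \<union> vars t)"

definition unifiers :: "('f \<Rightarrow> nat) \<Rightarrow> ('f, 'v) eqns \<Rightarrow> ('f, 'v) subst set" where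
  "unifiers ar E = {\<theta> \<in> Subst ar. \<forall>(s, t)\<in>E. app \<theta> s = app \<theta> t}"

definition mgus :: "('f \<Rightarrow> nat) \<Rightarrow> ('f, 'v) eqns \<Rightarrow> ('f, 'v) subst set" where
  "mgus ar E = {\<theta> \<in> unifiers ar E. \<forall>\<tau>\<in>unifiers ar E. \<exists>\<delta>\<in>Subst ar. \<forall>x. \<tau> x = app \<delta> (\<theta> x)}"

definition is_mgu ::
  "('f \<Rightarrow> nat) \<Rightarrow> ('f, 'v) subst \<Rightarrow> ('f, 'v) subst \<Rightarrow> ('f, 'v) subst \<Rightarrow> bool" where
  "is_mgu ar \<sigma>1 \<sigma>2 \<theta> \<longleftrightarrow> (let E = eqns_of \<sigma>1 \<union> eqns_of \<sigma>2 in
     \<theta> \<in> mgus ar E \<and> \<theta> \<in> ISubst ar \<and> svars \<theta> \<subseteq> eqns_vars E)"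

text \<open>\<open>None\<close> stands for ``undefined'', i.e. not unifiable.\<close>

definition mgu ::
  "('f \<Rightarrow> nat) \<Rightarrow> ('f, 'v) subst \<Rightarrow> ('f, 'v) subst \<Rightarrow> ('f, 'v) subst option" where
  "mgu ar \<sigma>1 \<sigma>2 =
     (if \<exists>\<theta>. is_mgu ar \<sigma>1 \<sigma>2 \<theta> then Some (SOME \<theta>. is_mgu ar \<sigma>1 \<sigma>2 \<theta>) else None)"

section \<open>Existential substitutions\<close>

definition preceq ::
  "('f \<Rightarrow> nat) \<Rightarrow> 'v set \<Rightarrow> ('f, 'v) subst \<Rightarrow> ('f, 'v) subst \<Rightarrow> bool" where
  "preceq ar U \<theta>1 \<theta>2 \<longleftrightarrow> (\<exists>\<delta>\<in>Subst ar. \<forall>u\<in>U. \<theta>1 u = app \<delta> (\<theta>2 u))"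

definition sim ::
  "('f \<Rightarrow> nat) \<Rightarrow> 'v set \<Rightarrow> ('f, 'v) subst \<Rightarrow> ('f, 'v) subst \<Rightarrow> bool" where
  "sim ar U \<theta>1 \<theta>2 \<longleftrightarrow> (\<exists>\<rho>\<in>Renaming ar. \<forall>u\<in>U. \<theta>1 u = app \<rho> (\<theta>2 u))"

definition sim_rel :: "('f \<Rightarrow> nat) \<Rightarrow> 'v set \<Rightarrow> (('f, 'v) subst \<times> ('f, 'v) subst) set" where
  "sim_rel ar U = {(\<theta>1, \<theta>2). \<theta>1 \<in> ISubst ar \<and> \<theta>2 \<in> ISubst ar \<and> sim ar U \<theta>1 \<theta>2}"

type_synonym ('f, 'v) esubst = "('f, 'v) subst set"

definition cls :: "('f \<Rightarrow> nat) \<Rightarrow> 'v set \<Rightarrow> ('f, 'v) subst \<Rightarrow> ('f, 'v) esubst" where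
  "cls ar U \<theta> = sim_rel ar U `` {\<theta>}"

definition ESubst :: "('f \<Rightarrow> nat) \<Rightarrow> 'v set \<Rightarrow> ('f, 'v) esubst set" where
  "ESubst ar U = ISubst ar // sim_rel ar U"

text \<open>
  \<open>is_emgu ar U C1 V C2 D\<close>: some admissible choice of representatives of the \<open>U\<close>-class \<open>C1\<close> and the
  \<open>V\<close>-class \<open>C2\<close> yields the \<open>(U \<union> V)\<close>-class \<open>D\<close>.  The value does not depend on the representatives,
  so the choice operator in \<open>emgu\<close> merely selects the unique such \<open>D\<close>.
\<close>

definition is_emgu ::
  "('f \<Rightarrow> nat) \<Rightarrow> 'v set \<Rightarrow> ('f, 'v) esubst \<Rightarrow> 'v set \<Rightarrow> ('f, 'v) esubst \<Rightarrow> ('f, 'v) esubst \<Rightarrow> bool"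
where
  "is_emgu ar U C1 V C2 D \<longleftrightarrow>
     (\<exists>\<theta>1\<in>C1. \<exists>\<theta>2\<in>C2. \<exists>\<theta>.
        (U \<union> svars \<theta>1) \<inter> (V \<union> svars \<theta>2) \<subseteq> U \<inter> V \<and>
        mgu ar \<theta>1 \<theta>2 = Some \<theta> \<and> D = cls ar (U \<union> V) \<theta>)"

definition emgu ::
  "('f \<Rightarrow> nat) \<Rightarrow> 'v set \<Rightarrow> ('f, 'v) esubst \<Rightarrow> 'v set \<Rightarrow> ('f, 'v) esubst \<Rightarrow> ('f, 'v) esubst option"
where
  "emgu ar U C1 V C2 =
     (if \<exists>D. is_emgu ar U C1 V C2 D then Some (SOME D. is_emgu ar U C1 V C2 D) else None)"

section \<open>Domains\<close>

text \<open>Common shape of both domains: \<open>El A U\<close> is the object \<open>[A, U]\<close>.\<close>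

datatype ('e, 'v) absdom = Bot | Top | El "'e set" "'v set"

fun absdom_le :: "('e, 'v) absdom \<Rightarrow> ('e, 'v) absdom \<Rightarrow> bool"  (infix "\<sqsubseteq>" 50) where
  "Bot \<sqsubseteq> y \<longleftrightarrow> True"
| "x \<sqsubseteq> Top \<longleftrightarrow> True"
| "El A U \<sqsubseteq> El B V \<longleftrightarrow> U = V \<and> A \<subseteq> B"
| "x \<sqsubseteq> y \<longleftrightarrow> False"

type_synonym ('f, 'v) psub = "(('f, 'v) esubst, 'v) absdom"
type_synonym 'v sharing = "('v set, 'v) absdom"

definition Psub :: "('f \<Rightarrow> nat) \<Rightarrow> ('f, 'v) psub set" where
  "Psub ar = {El \<Theta> U | \<Theta> U. finite U \<and> \<Theta> \<subseteq> ESubst ar U} \<union> {Bot, Top}"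

definition Sharing :: "'v sharing set" where
  "Sharing = {El A U | A U. finite U \<and> A \<subseteq> Pow U \<and> (A \<noteq> {} \<longrightarrow> {} \<in> A)} \<union> {Bot, Top}"

definition occ :: "('f, 'v) subst \<Rightarrow> 'v \<Rightarrow> 'v set" where
  "occ \<sigma> y = {z. y \<in> vars (\<sigma> z)}"

text \<open>
  The set \<open>A\<^sub>\<sigma>\<close> of sharing groups of a class \<open>C = [\<sigma>]\<^sub>V\<close>.  It is the same for all representatives, so
  taking the union over \<open>C\<close> is the usual lifting to the quotient.
\<close>

definition sh_groups :: "'v set \<Rightarrow> ('f, 'v) esubst \<Rightarrow> 'v set set" where
  "sh_groups V C = (\<Union>\<sigma>\<in>C. {occ \<sigma> y \<inter> V | y. True})"

fun alphaSh :: "('f, 'v) psub \<Rightarrow> 'v sharing" where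
  "alphaSh Bot = Bot"
| "alphaSh Top = Top"
| "alphaSh (El \<Theta> U) = El (\<Union>C\<in>\<Theta>. sh_groups U C) U"

section \<open>Matching\<close>

fun matchPs :: "('f \<Rightarrow> nat) \<Rightarrow> ('f, 'v) psub \<Rightarrow> ('f, 'v) psub \<Rightarrow> ('f, 'v) psub" where
  "matchPs ar Bot y = Bot"
| "matchPs ar x Bot = Bot"
| "matchPs ar Top y = Top"
| "matchPs ar x Top = Top"
| "matchPs ar (El \<Theta>1 U1) (El \<Theta>2 U2) =
     El {D. \<exists>\<theta>1\<in>ISubst ar. \<exists>\<theta>2\<in>ISubst ar.
              cls ar U1 \<theta>1 \<in> \<Theta>1 \<and> cls ar U2 \<theta>2 \<in> \<Theta>2 \<and> preceq ar (U1 \<inter> U2) \<theta>1 \<theta>2 \<and>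
              emgu ar U1 (cls ar U1 \<theta>1) U2 (cls ar U2 \<theta>2) = Some D}
        (U1 \<union> U2)"

definition star_union :: "'v set set \<Rightarrow> 'v set set" where
  "star_union A = {\<Union>T | T. T \<noteq> {} \<and> finite T \<and> T \<subseteq> A}"

fun matchSh :: "'v sharing \<Rightarrow> 'v sharing \<Rightarrow> 'v sharing" where
  "matchSh Bot y = Bot"
| "matchSh x Bot = Bot"
| "matchSh Top y = Top"
| "matchSh x Top = Top"
| "matchSh (El S1 U1) (El S2 U2) =
     (let S1' = {B \<in> S1. B \<inter> U2 = {}}; S1'' = S1 - S1';
          S2' = {B \<in> S2. B \<inter> U1 = {}}; S2'' = S2 - S2'
      in El (S1' \<union> S2' \<union>
             {X1 \<union> X2 | X1 X2. X1 \<in> S1'' \<and> X2 \<in> star_union S2'' \<and> X1 \<inter> U2 = X2 \<inter> U1})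
            (U1 \<union> U2))"

section \<open>Well-definedness\<close>

lemma app_Var: "app Var t = t"
  by (induction t) (auto simp: map_idI)

lemma cls_self:
  assumes "\<theta> \<in> ISubst ar"
  shows "\<theta> \<in> cls ar U \<theta>"
proof -
  have "Var \<in> Renaming ar"
    by (auto simp: Renaming_def Subst_def sdom_def intro!: exI[of _ id])
  then have "sim ar U \<theta> \<theta>"
    unfolding sim_def by (rule bexI[rotated]) (simp add: app_Var)
  then show ?thesis using assms by (simp add: cls_def sim_rel_def)
qed

lemma ESubst_nonempty: "C \<in> ESubst ar U \<Longrightarrow> C \<noteq> {} \<and> C \<subseteq> ISubst ar"
  using cls_self unfolding ESubst_def cls_def quotient_def
  by (fastforce simp: sim_rel_def)

lemma vars_app: "vars (app \<theta> t) = (\<Union>x\<in>vars t. vars (\<theta> x))"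
  by (induction t) auto

lemma sh_groups_cls:
  assumes "\<theta> \<in> ISubst ar"
  shows "sh_groups V (cls ar V \<theta>) = {occ \<theta> y \<inter> V | y. True}"
proof -
  have "{occ \<sigma> y \<inter> V | y. True} = {occ \<theta> y \<inter> V | y. True}" if "\<sigma> \<in> cls ar V \<theta>" for \<sigma>
  proof -
    from that obtain r where r: "bij r" "\<forall>u\<in>V. \<theta> u = app (\<lambda>x. Var (r x)) (\<sigma> u)"
      by (auto simp: cls_def sim_rel_def sim_def Renaming_def)
    have eq: "occ \<theta> (r y) \<inter> V = occ \<sigma> y \<inter> V" for y
      using r by (auto simp: occ_def vars_app bij_def inj_eq)
    have "\<exists>z. y = r z" for y using r(1) by (meson bij_pointE)
    then show ?thesis using eq by (auto, metis+)
  qed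
  then show ?thesis using cls_self[OF assms, of V] unfolding sh_groups_def by blast
qed

lemma finite_vars: "finite (vars t)"
  by (induction t) auto

lemma alphaSh_Sharing:
  fixes \<chi> :: "('f, 'v) psub"
  assumes "infinite (UNIV :: 'v set)" and "\<chi> \<in> Psub ar"
  shows "alphaSh \<chi> \<in> Sharing"
proof (cases \<chi>)
  case (El \<Theta> U)
  with assms(2) have U: "finite U" and sub: "\<Theta> \<subseteq> ESubst ar U" by (auto simp: Psub_def)
  have "{} \<in> sh_groups U C" if "C \<in> \<Theta>" for C
  proof -
    have "C \<noteq> {}" using \<open>C \<in> \<Theta>\<close> sub ESubst_nonempty by blast
    then obtain \<sigma> where \<sigma>: "\<sigma> \<in> C" by blast
    have "finite (\<Union>u\<in>U. vars (\<sigma> u))" using U finite_vars by auto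
    then obtain y where "y \<notin> (\<Union>u\<in>U. vars (\<sigma> u))" using assms(1) ex_new_if_finite by blast
    then have "occ \<sigma> y \<inter> U = {}" by (auto simp: occ_def)
    then show ?thesis using \<sigma> by (auto simp: sh_groups_def)
  qed
  then show ?thesis using El U by (auto simp: Sharing_def sh_groups_def)
qed (auto simp: Sharing_def)

lemma mgu_SomeD: "mgu ar \<theta>1 \<theta>2 = Some \<theta> \<Longrightarrow> is_mgu ar \<theta>1 \<theta>2 \<theta>"
  unfolding mgu_def by (metis option.distinct(1) option.inject someI_ex)

lemma mgu_ISubst: "mgu ar \<theta>1 \<theta>2 = Some \<theta> \<Longrightarrow> \<theta> \<in> ISubst ar"
  by (drule mgu_SomeD) (simp add: is_mgu_def Let_def)

lemma emgu_SomeD: "emgu ar U C1 V C2 = Some D \<Longrightarrow> is_emgu ar U C1 V C2 D"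
  unfolding emgu_def by (metis option.distinct(1) option.inject someI_ex)

lemma matchPs_Psub:
  assumes "\<chi>1 \<in> Psub ar" and "\<chi>2 \<in> Psub ar"
  shows "matchPs ar \<chi>1 \<chi>2 \<in> Psub ar"
proof -
  have "D \<in> ESubst ar (U \<union> V)" if "emgu ar U C1 V C2 = Some D" for U V C1 C2 D
    using emgu_SomeD[OF that] mgu_ISubst
    unfolding is_emgu_def ESubst_def cls_def by (blast intro: quotientI)
  then show ?thesis using assms
    by (cases "(ar, \<chi>1, \<chi>2)" rule: matchPs.cases) (auto simp: Psub_def)
qed

lemma matchSh_Sharing:
  assumes "\<chi>1 \<in> Sharing" and "\<chi>2 \<in> Sharing"
  shows "matchSh \<chi>1 \<chi>2 \<in> Sharing"
proof (cases "(\<chi>1, \<chi>2)" rule: matchSh.cases)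
  case (5 S1 U1 S2 U2)
  then have "finite U1" "finite U2" "S1 \<subseteq> Pow U1" "S2 \<subseteq> Pow U2"
    and ne: "S1 \<noteq> {} \<longrightarrow> {} \<in> S1" "S2 \<noteq> {} \<longrightarrow> {} \<in> S2"
    using assms by (auto simp: Sharing_def)
  moreover have "star_union (S2 - A) \<subseteq> Pow U2" for A
    using \<open>S2 \<subseteq> Pow U2\<close> unfolding star_union_def by blast
  moreover have "star_union {} = ({} :: 'a set set)"
    by (auto simp: star_union_def)
  ultimately show ?thesis
    using 5 by (cases "S1 = {}"; cases "S2 = {}") (simp_all add: Sharing_def Let_def, blast+)
qed (auto simp: Sharing_def)

end

theory Submission
  imports Defs
begin

text \<open>
  Let \<open>\<theta>1\<close> and \<open>\<theta>2\<close> be representatives without accidental common variables, where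
  \<open>\<theta>1 u = \<delta> (\<theta>2 u)\<close> for \<open>u \<in> U1 \<inter> U2\<close>.  Cutting \<open>\<delta>\<close> down to the variables of \<open>\<theta>2 ` (U1 \<inter> U2)\<close>
  gives an explicit most general unifier \<open>\<sigma>\<close>: it is \<open>\<theta>1\<close> on the variables of the first problem and
  \<open>\<delta> \<circ> \<theta>2\<close> on those of the second.  Every other idempotent mgu has, up to a change of names, the same
  nonempty sets of occurrences.  The occurrences of \<open>y\<close> in \<open>\<sigma>\<close> consist of those in \<open>\<theta>1\<close> and of those
  in \<open>\<theta>2\<close> of all \<open>v\<close> with \<open>y\<close> in \<open>\<delta> v\<close>; this is one group of \<open>\<theta>1\<close> joined with finitely many
  groups of \<open>\<theta>2\<close>, both parts having the same trace on \<open>U1 \<inter> U2\<close>.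
\<close>

section \<open>Substitutions\<close>

lemma app_app: "app \<sigma> (app \<tau> t) = app (\<lambda>x. app \<sigma> (\<tau> x)) t"
  by (induction t) auto

lemma app_eq_iff: "app \<sigma> t = app \<tau> t \<longleftrightarrow> (\<forall>x\<in>vars t. \<sigma> x = \<tau> x)"
  by (induction t) auto

lemma wf_trm_app:
  assumes "wf_trm ar t" and "\<And>x. wf_trm ar (\<theta> x)"
  shows "wf_trm ar (app \<theta> t)"
  using assms by (induction t) auto

lemma not_in_svars: "x \<notin> svars \<theta> \<Longrightarrow> \<theta> x = Var x"
  by (auto simp: svars_def sdom_def)

lemma vars_subset_svars: "vars (\<theta> x) \<subseteq> insert x (svars \<theta>)"
  by (cases "\<theta> x = Var x") (auto simp: svars_def srng_def sdom_def)

lemma finite_svars: "\<theta> \<in> Subst ar \<Longrightarrow> finite (svars \<theta>)"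
  by (auto simp: svars_def srng_def Subst_def finite_vars)

lemma ISubst_fixes_vars:
  assumes "\<theta> \<in> ISubst ar" and "y \<in> vars (\<theta> x)"
  shows "\<theta> y = Var y"
proof (cases "x \<in> sdom \<theta>")
  case True
  then have "y \<in> srng \<theta>" using assms(2) by (auto simp: srng_def)
  then show ?thesis using assms(1) by (auto simp: ISubst_def sdom_def)
next
  case False
  then show ?thesis using assms(2) by (auto simp: sdom_def)
qed

lemma app_ISubst_idem:
  assumes "\<theta> \<in> ISubst ar"
  shows "app \<theta> (\<theta> x) = \<theta> x"
proof -
  have "app \<theta> (\<theta> x) = app Var (\<theta> x)"
    using ISubst_fixes_vars[OF assms] by (simp add: app_eq_iff)
  then show ?thesis by (simp add: app_Var)
qed

text \<open>Off \<open>sdom\<close> the equations are trivial, so unifying means absorbing both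
  substitutions, a form that composes without case distinctions on the domains.\<close>

lemma unifiers_eqns_of_iff:
  fixes \<theta>1 \<theta>2 \<tau> :: "('f, 'v) subst"
  shows "\<tau> \<in> unifiers ar (eqns_of \<theta>1 \<union> eqns_of \<theta>2) \<longleftrightarrow>
     \<tau> \<in> Subst ar \<and> (\<forall>x. app \<tau> (\<theta>1 x) = \<tau> x) \<and> (\<forall>x. app \<tau> (\<theta>2 x) = \<tau> x)"
proof -
  have "(\<forall>(s, t)\<in>eqns_of \<theta>. app \<tau> s = app \<tau> t) \<longleftrightarrow> (\<forall>x. app \<tau> (\<theta> x) = \<tau> x)"
    for \<theta> :: "('f, 'v) subst"
  proof -
    have "(\<forall>(s, t)\<in>eqns_of \<theta>. app \<tau> s = app \<tau> t)
        \<longleftrightarrow> (\<forall>x. x \<in> sdom \<theta> \<longrightarrow> app \<tau> (Var x) = app \<tau> (\<theta> x))"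
      unfolding eqns_of_def by blast
    also have "\<dots> \<longleftrightarrow> (\<forall>x. app \<tau> (\<theta> x) = \<tau> x)"
    proof (rule iff_allI)
      show "(x \<in> sdom \<theta> \<longrightarrow> app \<tau> (Var x) = app \<tau> (\<theta> x)) \<longleftrightarrow> app \<tau> (\<theta> x) = \<tau> x" for x
        by (cases "\<theta> x = Var x") (auto simp: sdom_def)
    qed
    finally show ?thesis .
  qed
  then show ?thesis by (simp add: unifiers_def ball_Un)
qed

text \<open>Idempotence fixes \<open>y\<close>, so \<open>app \<theta> (\<sigma> y)\<close> is the
  variable \<open>y\<close>. Only a variable can be instantiated to a variable, which yields
  \<open>y'\<close>; the two factorisations then carry occurrences over in both directions.\<close>

lemma occ_of_equivalent:
  assumes \<theta>: "\<theta> \<in> ISubst ar"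
    and \<theta>\<sigma>: "\<And>x. app \<theta> (\<sigma> x) = \<theta> x" and \<sigma>\<theta>: "\<And>x. app \<sigma> (\<theta> x) = \<sigma> x"
    and ne: "occ \<theta> y \<noteq> {}"
  shows "\<exists>y'. occ \<theta> y = occ \<sigma> y'"
proof -
  have "\<theta> y = Var y" using ISubst_fixes_vars[OF \<theta>] ne by (auto simp: occ_def)
  then obtain y' where y': "\<sigma> y = Var y'" "\<theta> y' = Var y"
    using \<theta>\<sigma>[of y] by (cases "\<sigma> y") auto
  have "z \<in> occ \<theta> y \<longleftrightarrow> z \<in> occ \<sigma> y'" for z
  proof
    assume "z \<in> occ \<theta> y"
    then have "y' \<in> vars (app \<sigma> (\<theta> z))" using y' by (force simp: occ_def vars_app)
    then show "z \<in> occ \<sigma> y'" by (simp add: occ_def \<sigma>\<theta>)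
  next
    assume "z \<in> occ \<sigma> y'"
    then have "y \<in> vars (app \<theta> (\<sigma> z))" using y' by (force simp: occ_def vars_app)
    then show "z \<in> occ \<theta> y" by (simp add: occ_def \<theta>\<sigma>)
  qed
  then show ?thesis by blast
qed

lemma ex_occ_empty:
  assumes "infinite (UNIV :: 'v set)" and "finite U"
  shows "\<exists>y :: 'v. occ \<theta> y \<inter> U = {}"
proof -
  have "finite (\<Union>u\<in>U. vars (\<theta> u))" using assms(2) finite_vars by auto
  then obtain y where "y \<notin> (\<Union>u\<in>U. vars (\<theta> u))" using assms(1) ex_new_if_finite by blast
  then show ?thesis by (auto simp: occ_def)
qed

section \<open>The most general unifier of a matching problem\<close>

locale matching =
  fixes ar :: "'f \<Rightarrow> nat" and U1 U2 :: "'v set" and \<theta>1 \<theta>2 \<delta> :: "('f, 'v) subst"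
  assumes finite_U1: "finite U1" and finite_U2: "finite U2"
    and \<theta>1: "\<theta>1 \<in> ISubst ar" and \<theta>2: "\<theta>2 \<in> ISubst ar"
    and wf_\<delta>: "wf_trm ar (\<delta> x)"
    and sep: "(U1 \<union> svars \<theta>1) \<inter> (U2 \<union> svars \<theta>2) \<subseteq> U1 \<inter> U2"
    and matches: "u \<in> U1 \<inter> U2 \<Longrightarrow> \<theta>1 u = app \<delta> (\<theta>2 u)"
begin

definition shared :: "'v set" where
  "shared = (\<Union>u\<in>U1 \<inter> U2. vars (\<theta>2 u))"

text \<open>Variables outside \<open>shared\<close> stay free: the match does not determine them,
  and binding them could lose generality.\<close>

definition \<delta>' :: "('f, 'v) subst" where
  "\<delta>' v = (if v \<in> shared then \<delta> v else Var v)"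

definition \<sigma> :: "('f, 'v) subst" where
  "\<sigma> x = (if x \<in> U1 \<union> svars \<theta>1 then \<theta>1 x else app \<delta>' (\<theta>2 x))"

lemma \<sigma>_left: "x \<in> U1 \<union> svars \<theta>1 \<Longrightarrow> \<sigma> x = \<theta>1 x"
  by (simp add: \<sigma>_def)

lemma app_\<delta>'_shared:
  assumes "u \<in> U1 \<inter> U2"
  shows "app \<delta>' (\<theta>2 u) = \<theta>1 u"
proof -
  have "app \<delta>' (\<theta>2 u) = app \<delta> (\<theta>2 u)"
    using assms by (auto simp: app_eq_iff \<delta>'_def shared_def)
  then show ?thesis using matches[OF assms] by simp
qed

text \<open>\<open>sep\<close> confines the overlap of the two sides to
  \<open>U1 \<inter> U2\<close>, where the match makes both clauses of \<open>\<sigma>\<close>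
  agree.\<close>

lemma \<sigma>_right:
  assumes "x \<in> U2 \<union> svars \<theta>2"
  shows "\<sigma> x = app \<delta>' (\<theta>2 x)"
proof (cases "x \<in> U1 \<union> svars \<theta>1")
  case True
  then have "x \<in> U1 \<inter> U2" using sep assms by blast
  then show ?thesis using app_\<delta>'_shared[of x] \<sigma>_left[OF True] by simp
qed (simp add: \<sigma>_def)

lemma vars_\<theta>1: "x \<in> U1 \<union> svars \<theta>1 \<Longrightarrow> vars (\<theta>1 x) \<subseteq> U1 \<union> svars \<theta>1"
  using vars_subset_svars[of \<theta>1 x] by auto

lemma vars_\<theta>2: "x \<in> U2 \<union> svars \<theta>2 \<Longrightarrow> vars (\<theta>2 x) \<subseteq> U2 \<union> svars \<theta>2"
  using vars_subset_svars[of \<theta>2 x] by auto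

lemma \<sigma>_outside:
  assumes "x \<notin> U1 \<union> svars \<theta>1 \<union> (U2 \<union> svars \<theta>2)"
  shows "\<sigma> x = Var x"
proof -
  have "x \<notin> shared" using assms vars_\<theta>2 by (auto simp: shared_def)
  moreover have "\<theta>2 x = Var x" using assms not_in_svars by auto
  ultimately show ?thesis using assms by (simp add: \<sigma>_def \<delta>'_def)
qed

lemma \<sigma>_Subst: "\<sigma> \<in> Subst ar"
proof -
  have "wf_trm ar (\<theta>1 x)" "wf_trm ar (\<theta>2 x)" for x
    using \<theta>1 \<theta>2 by (auto simp: ISubst_def Subst_def)
  then have "wf_trm ar (\<sigma> x)" for x
    by (auto simp: \<sigma>_def \<delta>'_def wf_\<delta> intro!: wf_trm_app)
  moreover have "sdom \<sigma> \<subseteq> U1 \<union> svars \<theta>1 \<union> (U2 \<union> svars \<theta>2)"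
    using \<sigma>_outside by (auto simp: sdom_def)
  then have "finite (sdom \<sigma>)"
    by (rule finite_subset)
       (use \<theta>1 \<theta>2 finite_U1 finite_U2 finite_svars in \<open>auto simp: ISubst_def\<close>)
  ultimately show ?thesis by (simp add: Subst_def)
qed

text \<open>Each substitution keeps to the variables of its own side; there \<open>\<sigma>\<close>
  is given by a single clause, and idempotence removes the double application.\<close>

lemma \<sigma>_unifier: "\<sigma> \<in> unifiers ar (eqns_of \<theta>1 \<union> eqns_of \<theta>2)"
proof -
  have "app \<sigma> (\<theta>1 x) = \<sigma> x" for x
  proof (cases "x \<in> svars \<theta>1")
    case True
    have "app \<sigma> (\<theta>1 x) = app \<theta>1 (\<theta>1 x)"
      unfolding app_eq_iff using True vars_\<theta>1[of x] \<sigma>_left by blast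
    then show ?thesis using True by (simp add: \<sigma>_left app_ISubst_idem[OF \<theta>1])
  qed (simp add: not_in_svars)
  moreover have "app \<sigma> (\<theta>2 x) = \<sigma> x" for x
  proof (cases "x \<in> svars \<theta>2")
    case True
    have "app \<sigma> (\<theta>2 x) = app (\<lambda>x. app \<delta>' (\<theta>2 x)) (\<theta>2 x)"
      unfolding app_eq_iff using True vars_\<theta>2[of x] \<sigma>_right by blast
    also have "\<dots> = app \<delta>' (\<theta>2 x)" by (simp flip: app_app add: app_ISubst_idem[OF \<theta>2])
    finally show ?thesis using True by (simp add: \<sigma>_right)
  qed (simp add: not_in_svars)
  ultimately show ?thesis by (simp add: unifiers_eqns_of_iff \<sigma>_Subst)
qed

text \<open>Most generality in a strong form: the unifier itself serves as the factor.\<close>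

lemma unifier_absorbs_\<sigma>:
  assumes "\<tau> \<in> unifiers ar (eqns_of \<theta>1 \<union> eqns_of \<theta>2)"
  shows "app \<tau> (\<sigma> x) = \<tau> x"
proof -
  have \<tau>1: "app \<tau> (\<theta>1 x) = \<tau> x" and \<tau>2: "app \<tau> (\<theta>2 x) = \<tau> x" for x
    using assms by (simp_all add: unifiers_eqns_of_iff)
  have "app \<tau> (\<delta>' v) = \<tau> v" for v
  proof (cases "v \<in> shared")
    case True
    then obtain u where u: "u \<in> U1 \<inter> U2" "v \<in> vars (\<theta>2 u)" by (auto simp: shared_def)
    \<comment> \<open>Both sides equal \<open>\<tau> u\<close>; comparing them at each variable of
      \<open>\<theta>2 u\<close> gives the claim for \<open>v\<close>.\<close>
    have "app (\<lambda>v. app \<tau> (\<delta>' v)) (\<theta>2 u) = app \<tau> (\<theta>2 u)"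
      using u(1) by (simp flip: app_app add: app_\<delta>'_shared \<tau>1 \<tau>2)
    then show ?thesis using u(2) by (simp add: app_eq_iff)
  qed (simp add: \<delta>'_def)
  then show ?thesis by (simp add: \<sigma>_def \<tau>1 \<tau>2 app_app)
qed

text \<open>\<open>mgu\<close> picks its result by choice; this transfers its groups to the explicit
  \<open>\<sigma>\<close>.\<close>

lemma occ_mgu:
  assumes "\<theta> \<in> mgus ar (eqns_of \<theta>1 \<union> eqns_of \<theta>2)" and "\<theta> \<in> ISubst ar" and "occ \<theta> y \<noteq> {}"
  shows "\<exists>y'. occ \<theta> y = occ \<sigma> y'"
proof (rule occ_of_equivalent[OF assms(2) _ _ assms(3)])
  show "app \<theta> (\<sigma> x) = \<theta> x" for x
    using unifier_absorbs_\<sigma> assms(1) by (simp add: mgus_def)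
  obtain \<gamma> where \<gamma>: "\<And>x. \<sigma> x = app \<gamma> (\<theta> x)"
    using assms(1) \<sigma>_unifier unfolding mgus_def by blast
  \<comment> \<open>Nothing more is known of the factor \<open>\<gamma>\<close>, but idempotence of
    \<open>\<theta>\<close> lets \<open>\<sigma>\<close> itself take its place.\<close>
  have "app \<sigma> (\<theta> x) = app \<gamma> (app \<theta> (\<theta> x))" for x
    unfolding app_app by (simp add: \<gamma> app_eq_iff)
  then show "app \<sigma> (\<theta> x) = \<sigma> x" for x
    using \<gamma> by (simp add: app_ISubst_idem[OF assms(2)])
qed

section \<open>Its sharing groups\<close>

text \<open>No variable of the second problem that is not in \<open>shared\<close> can be captured by the first.\<close>

lemma vars_\<delta>'_cases:
  assumes "x \<in> U2" and "v \<in> vars (\<theta>2 x)" and "y \<in> vars (\<delta>' v)"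
  obtains u where "u \<in> U1 \<inter> U2" and "v \<in> vars (\<theta>2 u)" and "u \<in> occ \<theta>1 y"
  | "v = y" and "v \<notin> shared" and "y \<notin> U1 \<union> svars \<theta>1"
proof (cases "v \<in> shared")
  case True
  then obtain u where u: "u \<in> U1 \<inter> U2" "v \<in> vars (\<theta>2 u)" by (auto simp: shared_def)
  then have "y \<in> vars (app \<delta>' (\<theta>2 u))" using assms(3) by (auto simp: vars_app)
  then have "u \<in> occ \<theta>1 y" using u(1) by (simp add: occ_def app_\<delta>'_shared)
  then show ?thesis using u that(1) by blast
next
  case False
  then have "v = y" using assms(3) by (simp add: \<delta>'_def)
  \<comment> \<open>Otherwise \<open>sep\<close> puts \<open>v\<close> into
    \<open>U1 \<inter> U2\<close>; as \<open>\<theta>2\<close> fixes \<open>v\<close>, it occurs in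
    \<open>\<theta>2 v\<close> and would be shared.\<close>
  have "v \<notin> U1 \<union> svars \<theta>1"
  proof
    assume "v \<in> U1 \<union> svars \<theta>1"
    moreover have "v \<in> U2 \<union> svars \<theta>2" using assms(1,2) vars_\<theta>2[of x] by auto
    ultimately have "v \<in> U1 \<inter> U2" using sep by auto
    moreover have "\<theta>2 v = Var v" using ISubst_fixes_vars[OF \<theta>2 assms(2)] .
    ultimately show False using False by (force simp: shared_def)
  qed
  then show ?thesis using that(2) \<open>v = y\<close> False by simp
qed

lemma occ_\<sigma>_U1: "occ \<sigma> y \<inter> U1 = occ \<theta>1 y \<inter> U1"
  by (auto simp: occ_def \<sigma>_left)

lemma occ_\<sigma>_U2: "occ \<sigma> y \<inter> U2 = (\<Union>v\<in>{v. y \<in> vars (\<delta>' v)}. occ \<theta>2 v \<inter> U2)"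
  by (auto simp: occ_def \<sigma>_right vars_app)

text \<open>No shared variable can bring in \<open>y\<close> through \<open>\<delta>'\<close>, so
  its only source is \<open>y\<close> itself, left alone by \<open>\<delta>'\<close> and foreign to
  the first side.\<close>

lemma occ_\<sigma>_disjoint:
  assumes disj: "occ \<theta>1 y \<inter> U1 \<inter> U2 = {}" and ne: "occ \<sigma> y \<inter> U2 \<noteq> {}"
  shows "occ \<sigma> y \<inter> U1 = {}" and "occ \<sigma> y \<inter> U2 = occ \<theta>2 y \<inter> U2"
proof -
  have only: "v = y \<and> v \<notin> shared \<and> y \<notin> U1 \<union> svars \<theta>1"
    if "x \<in> U2" "v \<in> vars (\<theta>2 x)" "y \<in> vars (\<delta>' v)" for x v
    using vars_\<delta>'_cases[OF that] disj by blast
  from ne obtain x v where xv: "x \<in> U2" "v \<in> vars (\<theta>2 x)" "y \<in> vars (\<delta>' v)"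
    unfolding occ_\<sigma>_U2 by (auto simp: occ_def)
  from only[OF xv] have y: "y \<notin> shared" "y \<notin> U1 \<union> svars \<theta>1" by auto
  show "occ \<sigma> y \<inter> U1 = {}"
    unfolding occ_\<sigma>_U1 using y(2) vars_\<theta>1 by (auto simp: occ_def)
  have "y \<in> vars (\<delta>' y)" using y(1) by (simp add: \<delta>'_def)
  then show "occ \<sigma> y \<inter> U2 = occ \<theta>2 y \<inter> U2"
    unfolding occ_\<sigma>_U2 using only by (auto simp: occ_def)
qed

lemma occ_\<sigma>_star_union:
  assumes meet: "occ \<theta>1 y \<inter> U1 \<inter> U2 \<noteq> {}"
    and S2: "\<And>v. occ \<theta>2 v \<inter> U2 \<in> S2"
  shows "occ \<sigma> y \<inter> U2 \<in> star_union {B \<in> S2. B \<inter> U1 \<noteq> {}}"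
proof -
  \<comment> \<open>Empty traces add nothing to the union but would not meet \<open>U1\<close>, so
    they are left out.\<close>
  define T where "T = (\<lambda>v. occ \<theta>2 v \<inter> U2) ` {v. y \<in> vars (\<delta>' v) \<and> occ \<theta>2 v \<inter> U2 \<noteq> {}}"
  have union: "occ \<sigma> y \<inter> U2 = \<Union>T"
    unfolding occ_\<sigma>_U2 T_def by auto
  moreover have "T \<noteq> {}"
    using meet union occ_\<sigma>_U1[of y] by blast
  moreover have "T \<subseteq> Pow U2" by (auto simp: T_def)
  then have "finite T" using finite_U2 finite_subset by blast
  moreover have "occ \<theta>2 v \<inter> U2 \<inter> U1 \<noteq> {}"
    if v: "y \<in> vars (\<delta>' v)" and ne: "occ \<theta>2 v \<inter> U2 \<noteq> {}" for v
  proof -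
    obtain x where x: "x \<in> U2" "v \<in> vars (\<theta>2 x)" using ne by (auto simp: occ_def)
    \<comment> \<open>This excludes the unshared alternative of
      \<open>vars_\<delta>'_cases\<close>.\<close>
    have "y \<in> U1 \<union> svars \<theta>1" using meet vars_\<theta>1 by (auto simp: occ_def)
    then obtain u where "u \<in> U1 \<inter> U2" "v \<in> vars (\<theta>2 u)"
      using vars_\<delta>'_cases[OF x v] by blast
    then show ?thesis by (auto simp: occ_def)
  qed
  then have "T \<subseteq> {B \<in> S2. B \<inter> U1 \<noteq> {}}" using S2 by (auto simp: T_def)
  ultimately show ?thesis unfolding star_union_def by blast
qed

text \<open>The cases \<open>meet\<close>, \<open>left\<close> and \<open>right\<close> correspond
  to the three parts of \<open>matchSh\<close>: joined groups, \<open>S1'\<close> and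
  \<open>S2'\<close>. The singleton \<open>El\<close> expresses membership without spelling that set
  out.\<close>

lemma occ_\<sigma>_matchSh:
  assumes S1: "\<And>v. occ \<theta>1 v \<inter> U1 \<in> S1" and S2: "\<And>v. occ \<theta>2 v \<inter> U2 \<in> S2"
  shows "El {occ \<sigma> y \<inter> (U1 \<union> U2)} (U1 \<union> U2) \<sqsubseteq> matchSh (El S1 U1) (El S2 U2)"
proof -
  have split: "occ \<sigma> y \<inter> (U1 \<union> U2) = occ \<sigma> y \<inter> U1 \<union> occ \<sigma> y \<inter> U2" by blast
  consider (meet) "occ \<theta>1 y \<inter> U1 \<inter> U2 \<noteq> {}"
    | (left) "occ \<theta>1 y \<inter> U1 \<inter> U2 = {}" "occ \<sigma> y \<inter> U2 = {}"
    | (right) "occ \<theta>1 y \<inter> U1 \<inter> U2 = {}" "occ \<sigma> y \<inter> U2 \<noteq> {}" by blast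
  then show ?thesis
  proof cases
    case meet
    have "{B \<in> S2. B \<inter> U1 \<noteq> {}} = S2 - {B \<in> S2. B \<inter> U1 = {}}" by blast
    then have "occ \<sigma> y \<inter> U2 \<in> star_union (S2 - {B \<in> S2. B \<inter> U1 = {}})"
      using occ_\<sigma>_star_union[OF meet S2] by simp
    moreover have "occ \<sigma> y \<inter> U1 \<in> S1 - {B \<in> S1. B \<inter> U2 = {}}"
      using meet S1 by (simp add: occ_\<sigma>_U1)
    \<comment> \<open>The trace condition is automatic because both parts are cut from the same
      \<open>occ \<sigma> y\<close>.\<close>
    moreover have "occ \<sigma> y \<inter> U1 \<inter> U2 = occ \<sigma> y \<inter> U2 \<inter> U1" by blast
    ultimately show ?thesis unfolding split by (simp add: Let_def) blast
  next
    case left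
    then show ?thesis using S1[of y] unfolding split by (simp add: occ_\<sigma>_U1 Let_def)
  next
    case right
    note r = occ_\<sigma>_disjoint[OF right]
    have "occ \<theta>2 y \<inter> U2 \<inter> U1 = {}" using r by blast
    then show ?thesis using S2[of y] unfolding split r by (simp add: Let_def)
  qed
qed

end

section \<open>Correctness\<close>

text \<open>The witness is not required to have finite domain, so that inverting a renaming is harmless.\<close>

lemma preceq_representatives:
  assumes "preceq ar (U \<inter> V) \<eta>1 \<eta>2" and "\<theta>1 \<in> cls ar U \<eta>1" and "\<theta>2 \<in> cls ar V \<eta>2"
  shows "\<exists>\<delta>. (\<forall>x. wf_trm ar (\<delta> x)) \<and> (\<forall>u\<in>U \<inter> V. \<theta>1 u = app \<delta> (\<theta>2 u))"
proof -
  obtain \<gamma> where \<gamma>: "\<gamma> \<in> Subst ar" "\<And>u. u \<in> U \<inter> V \<Longrightarrow> \<eta>1 u = app \<gamma> (\<eta>2 u)"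
    using assms(1) by (auto simp: preceq_def)
  obtain r where r: "bij r" "\<And>u. u \<in> U \<Longrightarrow> \<eta>1 u = app (\<lambda>x. Var (r x)) (\<theta>1 u)"
    using assms(2) by (auto simp: cls_def sim_rel_def sim_def Renaming_def)
  obtain \<rho> where \<rho>: "\<rho> \<in> Subst ar" "\<And>u. u \<in> V \<Longrightarrow> \<eta>2 u = app \<rho> (\<theta>2 u)"
    using assms(3) by (auto simp: cls_def sim_rel_def sim_def Renaming_def)
  \<comment> \<open>The path leads from \<open>\<theta>2\<close> to \<open>\<eta>2\<close> by
    \<open>\<rho>\<close>, on to \<open>\<eta>1\<close> by \<open>\<gamma>\<close>, and back to
    \<open>\<theta>1\<close> by the inverse of \<open>r\<close>.\<close>
  define \<delta> where "\<delta> = (\<lambda>x. app (\<lambda>x. Var (inv r x)) (app \<gamma> (\<rho> x)))"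
  have "\<theta>1 u = app \<delta> (\<theta>2 u)" if "u \<in> U \<inter> V" for u
  proof -
    have "app \<delta> (\<theta>2 u) = app (\<lambda>x. Var (inv r x)) (app \<gamma> (app \<rho> (\<theta>2 u)))"
      by (simp add: \<delta>_def app_app)
    also have "\<dots> = app (\<lambda>x. Var (inv r x)) (app (\<lambda>x. Var (r x)) (\<theta>1 u))"
      using that \<gamma>(2) r(2) \<rho>(2) by simp
    also have "\<dots> = app Var (\<theta>1 u)"
      using r(1) by (simp add: app_app bij_is_inj)
    finally show ?thesis by (simp add: app_Var)
  qed
  moreover have "wf_trm ar (\<delta> x)" for x
    using \<gamma>(1) \<rho>(1) by (auto simp: \<delta>_def Subst_def intro!: wf_trm_app)
  ultimately show ?thesis by blast
qed

text \<open>\<open>is_emgu\<close> provides separated representatives, but the match is given for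
  \<open>\<eta>1\<close> and \<open>\<eta>2\<close> and has to be transported. \<open>S1\<close> and
  \<open>S2\<close> may exceed the groups of one pair, to fit the unions in
  \<open>alphaSh\<close>.\<close>

lemma sh_groups_emgu:
  assumes inf: "infinite (UNIV :: 'v set)" and fin: "finite U1" "finite U2"
    and D: "emgu ar U1 (cls ar U1 \<eta>1) U2 (cls ar U2 \<eta>2) = Some D"
    and \<eta>: "preceq ar (U1 \<inter> U2) \<eta>1 \<eta>2"
    and S1: "sh_groups U1 (cls ar U1 \<eta>1) \<subseteq> S1" and S2: "sh_groups U2 (cls ar U2 \<eta>2) \<subseteq> S2"
    and B: "B \<in> sh_groups (U1 \<union> U2) D"
  shows "El {B} (U1 \<union> U2 :: 'v set) \<sqsubseteq> matchSh (El S1 U1) (El S2 U2)"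
proof -
  obtain \<theta>1 \<theta>2 \<theta> where reps: "\<theta>1 \<in> cls ar U1 \<eta>1" "\<theta>2 \<in> cls ar U2 \<eta>2"
    and sep: "(U1 \<union> svars \<theta>1) \<inter> (U2 \<union> svars \<theta>2) \<subseteq> U1 \<inter> U2"
    and mgu: "mgu ar \<theta>1 \<theta>2 = Some \<theta>" and D_eq: "D = cls ar (U1 \<union> U2) \<theta>"
    using emgu_SomeD[OF D] by (auto simp: is_emgu_def)
  have \<theta>: "\<theta> \<in> ISubst ar" "\<theta> \<in> mgus ar (eqns_of \<theta>1 \<union> eqns_of \<theta>2)"
    using mgu_SomeD[OF mgu] by (auto simp: is_mgu_def Let_def)
  obtain \<delta> where \<delta>: "\<And>x. wf_trm ar (\<delta> x)" "\<And>u. u \<in> U1 \<inter> U2 \<Longrightarrow> \<theta>1 u = app \<delta> (\<theta>2 u)"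
    using preceq_representatives[OF \<eta> reps] by blast
  interpret matching ar U1 U2 \<theta>1 \<theta>2 \<delta>
    using fin reps sep \<delta> by unfold_locales (auto simp: cls_def sim_rel_def)
  have groups: "occ \<theta>1 v \<inter> U1 \<in> S1" "occ \<theta>2 v \<inter> U2 \<in> S2" for v
    using S1 S2 reps by (auto simp: sh_groups_def)
  obtain y where y: "B = occ \<theta> y \<inter> (U1 \<union> U2)"
    using B \<theta>(1) by (auto simp: D_eq sh_groups_cls)
  have "\<exists>y'. B = occ \<sigma> y' \<inter> (U1 \<union> U2)"
  proof (cases "occ \<theta> y = {}")
    \<comment> \<open>\<open>occ_mgu\<close> covers only nonempty groups; a variable absent from
      \<open>\<sigma>\<close> on \<open>U1 \<union> U2\<close> yields the empty one.\<close>
    case True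
    then show ?thesis using ex_occ_empty[OF inf, of "U1 \<union> U2" \<sigma>] fin y by auto
  next
    case False
    then show ?thesis using occ_mgu[OF \<theta>(2,1) False] y by auto
  qed
  then show ?thesis using occ_\<sigma>_matchSh[OF groups] by auto
qed

theorem theorem7p4:
  fixes ar :: "'f \<Rightarrow> nat"
    and \<chi>1 \<chi>2 :: "('f, 'v) psub"
  assumes inf_vars: "infinite (UNIV :: 'v set)"
    and const: "\<exists>c. ar c = 0"
    and binary: "\<exists>f. ar f \<ge> 2"
    and chi1: "\<chi>1 \<in> Psub ar"
    and chi2: "\<chi>2 \<in> Psub ar"
  shows "alphaSh (matchPs ar \<chi>1 \<chi>2) \<sqsubseteq> matchSh (alphaSh \<chi>1) (alphaSh \<chi>2)"
proof (cases "(ar, \<chi>1, \<chi>2)" rule: matchPs.cases)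
  \<comment> \<open>With \<open>Bot\<close> or \<open>Top\<close> among the arguments both sides
    simply evaluate.\<close>
  case (5 ar' \<Theta>1 U1 \<Theta>2 U2)
  then have \<chi>: "\<chi>1 = El \<Theta>1 U1" "\<chi>2 = El \<Theta>2 U2" by auto
  define S1 S2 where "S1 = (\<Union>C\<in>\<Theta>1. sh_groups U1 C)" and "S2 = (\<Union>C\<in>\<Theta>2. sh_groups U2 C)"
  obtain \<Theta> where \<Theta>: "matchPs ar \<chi>1 \<chi>2 = El \<Theta> (U1 \<union> U2)" by (simp add: \<chi>)
  obtain S where S: "matchSh (El S1 U1) (El S2 U2) = El S (U1 \<union> U2)" by (simp add: Let_def)
  have fin: "finite U1" "finite U2" using chi1 chi2 by (auto simp: \<chi> Psub_def)
  \<comment> \<open>Both results live over \<open>U1 \<union> U2\<close>, so the order is plain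
    inclusion, checked one group at a time.\<close>
  have "B \<in> S" if D: "D \<in> \<Theta>" and B: "B \<in> sh_groups (U1 \<union> U2) D" for B D
  proof -
    obtain \<eta>1 \<eta>2 where \<eta>: "cls ar U1 \<eta>1 \<in> \<Theta>1" "cls ar U2 \<eta>2 \<in> \<Theta>2"
      "preceq ar (U1 \<inter> U2) \<eta>1 \<eta>2" "emgu ar U1 (cls ar U1 \<eta>1) U2 (cls ar U2 \<eta>2) = Some D"
      using D \<Theta> by (auto simp: \<chi>)
    have "El {B} (U1 \<union> U2) \<sqsubseteq> matchSh (El S1 U1) (El S2 U2)"
      using \<eta> by (intro sh_groups_emgu[OF inf_vars fin _ _ _ _ B]) (auto simp: S1_def S2_def)
    then show ?thesis unfolding S by simp
  qed
  moreover have "matchSh (alphaSh \<chi>1) (alphaSh \<chi>2) = El S (U1 \<union> U2)"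
    unfolding \<chi> alphaSh.simps S1_def[symmetric] S2_def[symmetric] by (fact S)
  ultimately show ?thesis unfolding \<Theta> by auto
qed auto

end
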